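(* Let $\mathbb{Z}[1/2]$ be the additive group of rational numbers whose denominators are powers of two, regarded as a topological group with the subspace topology from $\mathbb{R}$. There is no left invariant pseudo-metric on $\mathbb{Z}[1/2]$ such that the associated bounded coarse structure coincides with the group-compact coarse structure on $\mathbb{Z}[1/2]$.
   Context: For a Hausdorff topological group $G$, the group-compact coarse structure on $G$ is the collection $\{E\subset G\times G : E\subset G(K\times K)\text{ for some compact }K\subset G\}$, where $G(K\times K)=\{(ga,gb) : g\in G,\ a,b\in K\}$ (written multiplicatively). For a left invariant pseudo-metric $d$ on $G$ (i.e. $d(gx,gy)=d(x,y)$; not assumed to induce the topology), the associated bounded coarse structure is the collection $\{E\subset G\times G : \sup\{d(x,y) : (x,y)\in E\}<\infty\}$. *)

theory Defs
  imports "HOL-Algebra.Group" "HOL-Analysis.Analysis"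
begin

definition topological_group_on :: "('a, 'b) monoid_scheme \<Rightarrow> 'a topology \<Rightarrow> bool" where
  "topological_group_on G T \<longleftrightarrow>
     group G \<and> topspace T = carrier G \<and>
     continuous_map (prod_topology T T) T (\<lambda>(x, y). x \<otimes>\<^bsub>G\<^esub> y) \<and>
     continuous_map T T (\<lambda>x. inv\<^bsub>G\<^esub> x)"

definition group_compact_coarse_structure ::
    "('a, 'b) monoid_scheme \<Rightarrow> 'a topology \<Rightarrow> ('a \<times> 'a) set set" where
  "group_compact_coarse_structure G T =
     {E. E \<subseteq> carrier G \<times> carrier G \<and>
         (\<exists>K. compactin T K \<and>
              E \<subseteq> {(g \<otimes>\<^bsub>G\<^esub> a, g \<otimes>\<^bsub>G\<^esub> b) | g a b. g \<in> carrier G \<and> a \<in> K \<and> b \<in> K})}"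

definition pseudometric_on :: "'a set \<Rightarrow> ('a \<Rightarrow> 'a \<Rightarrow> real) \<Rightarrow> bool" where
  "pseudometric_on X d \<longleftrightarrow>
     (\<forall>x\<in>X. \<forall>y\<in>X. 0 \<le> d x y) \<and>
     (\<forall>x\<in>X. d x x = 0) \<and>
     (\<forall>x\<in>X. \<forall>y\<in>X. d x y = d y x) \<and>
     (\<forall>x\<in>X. \<forall>y\<in>X. \<forall>z\<in>X. d x z \<le> d x y + d y z)"

definition left_invariant_on :: "('a, 'b) monoid_scheme \<Rightarrow> ('a \<Rightarrow> 'a \<Rightarrow> real) \<Rightarrow> bool" where
  "left_invariant_on G d \<longleftrightarrow>
     (\<forall>g\<in>carrier G. \<forall>x\<in>carrier G. \<forall>y\<in>carrier G. d (g \<otimes>\<^bsub>G\<^esub> x) (g \<otimes>\<^bsub>G\<^esub> y) = d x y)"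

definition bounded_coarse_structure ::
    "'a set \<Rightarrow> ('a \<Rightarrow> 'a \<Rightarrow> real) \<Rightarrow> ('a \<times> 'a) set set" where
  "bounded_coarse_structure X d =
     {E. E \<subseteq> X \<times> X \<and> bdd_above {d x y | x y. (x, y) \<in> E}}"

definition dyadic_rationals :: "real set" where
  "dyadic_rationals = {of_int a / 2 ^ n | (a :: int) (n :: nat). True}"

definition dyadic_group :: "real monoid" where
  "dyadic_group = \<lparr>carrier = dyadic_rationals, monoid.mult = (+), one = 0\<rparr>"

definition dyadic_topology :: "real topology" where
  "dyadic_topology = subtopology euclideanreal dyadic_rationals"

lemma dyadic_rationals_add:
  assumes "x \<in> dyadic_rationals" "y \<in> dyadic_rationals"
  shows "x + y \<in> dyadic_rationals"
proof -
  obtain a b :: int and m n :: nat where "x = of_int a / 2 ^ m" "y = of_int b / 2 ^ n"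
    using assms unfolding dyadic_rationals_def by blast
  then have "x + y = of_int (a * 2 ^ n + b * 2 ^ m) / 2 ^ (m + n)"
    by (simp add: add_divide_distrib power_add)
  then show ?thesis unfolding dyadic_rationals_def by blast
qed

lemma dyadic_rationals_minus:
  assumes "x \<in> dyadic_rationals"
  shows "- x \<in> dyadic_rationals"
proof -
  obtain a :: int and m :: nat where "x = of_int a / 2 ^ m"
    using assms unfolding dyadic_rationals_def by blast
  then have "- x = of_int (- a) / 2 ^ m" by simp
  then show ?thesis unfolding dyadic_rationals_def by blast
qed

lemma dyadic_rationals_zero: "0 \<in> dyadic_rationals"
proof -
  have "(0::real) = of_int 0 / 2 ^ 0" by simp
  then show ?thesis unfolding dyadic_rationals_def by blast
qed

lemma group_dyadic_group: "group dyadic_group"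
  by (rule groupI)
    (auto simp: dyadic_group_def dyadic_rationals_add dyadic_rationals_zero
      intro!: bexI[of _ "- x" for x] dyadic_rationals_minus)

lemma inv_dyadic_group:
  assumes "x \<in> dyadic_rationals"
  shows "inv\<^bsub>dyadic_group\<^esub> x = - x"
  by (rule group.inv_equality[OF group_dyadic_group])
    (use assms in \<open>auto simp: dyadic_group_def dyadic_rationals_minus\<close>)

lemma topological_group_dyadic: "topological_group_on dyadic_group dyadic_topology"
proof -
  have top: "topspace dyadic_topology = dyadic_rationals"
    by (simp add: dyadic_topology_def)
  have incl: "continuous_map dyadic_topology euclideanreal (\<lambda>x. x)"
    by (simp add: dyadic_topology_def continuous_map_from_subtopology)
  have "continuous_map (prod_topology dyadic_topology dyadic_topology) euclideanreal
          (\<lambda>p. fst p + snd p)"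
    by (intro continuous_map_add continuous_map_compose[OF continuous_map_fst incl, unfolded o_def]
        continuous_map_compose[OF continuous_map_snd incl, unfolded o_def])
  then have "continuous_map (prod_topology dyadic_topology dyadic_topology) dyadic_topology
          (\<lambda>p. fst p + snd p)"
    unfolding dyadic_topology_def
    by (auto simp: continuous_map_in_subtopology dyadic_rationals_add)
  moreover have "continuous_map dyadic_topology dyadic_topology (\<lambda>x. - x)"
    using continuous_map_minus[OF incl] unfolding dyadic_topology_def
    by (auto simp: continuous_map_in_subtopology dyadic_rationals_minus)
  then have "continuous_map dyadic_topology dyadic_topology (\<lambda>x. inv\<^bsub>dyadic_group\<^esub> x)"
    by (rule continuous_map_eq) (simp add: top inv_dyadic_group)
  ultimately show ?thesis
    by (simp add: topological_group_on_def group_dyadic_group top)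
      (simp add: dyadic_group_def case_prod_beta')
qed

lemma Hausdorff_dyadic: "Hausdorff_space dyadic_topology"
  by (simp add: dyadic_topology_def Hausdorff_space_subtopology)

end

theory Submission
  imports Defs
begin

text \<open>If a pseudo-metric induced the group-compact coarse structure, the balls of integral radius
about \<open>0\<close> would lie in compact sets \<open>C 0, C 1, \<dots>\<close>, and each compact set would lie in some ball.
No \<open>C n\<close> contains a neighbourhood of \<open>0\<close>, since the group contains no real interval; so one can
pick \<open>x n\<close> outside \<open>C n\<close> with \<open>x n\<close> tending to \<open>0\<close>. The compact set formed by \<open>0\<close> and the \<open>x n\<close>
is then contained in no ball.\<close>

lemma countable_dyadic_rationals: "countable dyadic_rationals"
proof -
  have "dyadic_rationals = range (\<lambda>(a::int, n::nat). of_int a / 2 ^ n)"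
    unfolding dyadic_rationals_def by auto
  then show ?thesis by (metis countable_image countableI_type)
qed

lemma closure_dyadic_rationals_real: "closure dyadic_rationals = UNIV"
proof -
  have "t \<in> closure dyadic_rationals" for t
    unfolding closure_approachable
  proof (intro allI impI)
    fix e :: real assume "0 < e"
    then obtain n q r where "of_int q / 2 ^ n < t" "t < of_int r / 2 ^ n"
        "\<bar>of_int q / 2 ^ n - of_int r / 2 ^ n\<bar> < e"
      using padic_rational_approximation_straddle[of e 2 t] by (metis one_less_numeral_iff semiring_norm(76))
    then have "dist (of_int q / 2 ^ n) t < e" unfolding dist_real_def by linarith
    moreover have "of_int q / 2 ^ n \<in> dyadic_rationals"
      unfolding dyadic_rationals_def by blast
    ultimately show "\<exists>y\<in>dyadic_rationals. dist y t < e" by blast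
  qed
  then show ?thesis by auto
qed

text \<open>Otherwise \<open>C\<close> contains every dyadic rational of the interval from
  \<open>-e\<close> to \<open>e\<close>. These are dense in the interval and \<open>C\<close> is
  closed in the real line, so \<open>C\<close> contains the whole interval, which is uncountable,
  whereas \<open>C\<close> is countable.\<close>

lemma closed_dyadic_omits_small:
  assumes "closed C" "C \<subseteq> dyadic_rationals" "0 < e"
  obtains x where "x \<in> dyadic_rationals" "\<bar>x\<bar> < e" "x \<notin> C"
proof (rule ccontr)
  assume "\<not> thesis"
  with that have "{-e<..<e} \<inter> dyadic_rationals \<subseteq> C" by force
  then have "closure ({-e<..<e} \<inter> dyadic_rationals) \<subseteq> C"
    using \<open>closed C\<close> by (rule closure_minimal)
  moreover have "{-e<..<e} \<subseteq> closure ({-e<..<e} \<inter> dyadic_rationals)"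
    using open_Int_closure_subset[of "{-e<..<e}" dyadic_rationals]
    by (simp add: closure_dyadic_rationals_real)
  ultimately have "{-e<..<e} \<subseteq> dyadic_rationals" using assms(2) by blast
  then have "countable {-e<..<e}"
    using countable_dyadic_rationals countable_subset by blast
  then show False using \<open>0 < e\<close> uncountable_open_interval[of "-e" e] by simp
qed

text \<open>Compactness is intrinsic to a subspace. Hence compact subsets of the group are closed in
  the real line, not merely in the group.\<close>

lemma compactin_dyadic_topology_iff:
  "compactin dyadic_topology K \<longleftrightarrow> compact K \<and> K \<subseteq> dyadic_rationals"
  by (simp add: dyadic_topology_def compactin_subtopology conj_commute)

theorem proposition2p20:
  "\<not> (\<exists>d :: real \<Rightarrow> real \<Rightarrow> real.
        pseudometric_on (carrier dyadic_group) d \<and>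
        left_invariant_on dyadic_group d \<and>
        bounded_coarse_structure (carrier dyadic_group) d =
          group_compact_coarse_structure dyadic_group dyadic_topology)"
proof (intro notI, elim exE conjE)
  let ?D = "dyadic_rationals"
  fix d :: "real \<Rightarrow> real \<Rightarrow> real"
  assume eq: "bounded_coarse_structure (carrier dyadic_group) d =
      group_compact_coarse_structure dyadic_group dyadic_topology"
  have carr: "carrier dyadic_group = ?D" and mult: "x \<otimes>\<^bsub>dyadic_group\<^esub> y = x + y" for x y
    by (simp_all add: dyadic_group_def)
  have ball: "\<exists>C. closed C \<and> C \<subseteq> ?D \<and> {x \<in> ?D. d 0 x \<le> r} \<subseteq> C" for r
  proof -
    \<comment> \<open>Pairing the ball with its centre turns it into an element of the bounded
      coarse structure, with bound \<open>r\<close>.\<close>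
    let ?E = "{0} \<times> {x \<in> ?D. d 0 x \<le> r}"
    have "?E \<in> bounded_coarse_structure (carrier dyadic_group) d"
      by (auto simp: bounded_coarse_structure_def carr dyadic_rationals_zero intro!: bdd_aboveI[of _ r])
    then have "?E \<in> group_compact_coarse_structure dyadic_group dyadic_topology"
      unfolding eq .
    then obtain K where K: "compactin dyadic_topology K"
      and sub: "?E \<subseteq> {(g + a, g + b) | g a b. g \<in> ?D \<and> a \<in> K \<and> b \<in> K}"
      unfolding group_compact_coarse_structure_def carr mult by blast
    let ?C = "{b - a | b a. b \<in> K \<and> a \<in> K}"
    have "closed ?C"
      using K compact_differences[of K K] by (simp add: compactin_dyadic_topology_iff compact_imp_closed)
    moreover have "b - a \<in> ?D" if "a \<in> K" "b \<in> K" for a b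
    proof -
      have "a \<in> ?D" "b \<in> ?D" using that K by (auto simp: compactin_dyadic_topology_iff)
      then show ?thesis using dyadic_rationals_add[OF _ dyadic_rationals_minus, of b a] by simp
    qed
    then have "?C \<subseteq> ?D" by blast
    moreover have "{x \<in> ?D. d 0 x \<le> r} \<subseteq> ?C"
    proof
      fix x assume "x \<in> {x \<in> ?D. d 0 x \<le> r}"
      then have "(0, x) \<in> ?E" by simp
      with sub obtain g a b where "0 = g + a" "x = g + b" "a \<in> K" "b \<in> K" by blast
      then have "x = b - a" by simp
      with \<open>a \<in> K\<close> \<open>b \<in> K\<close> show "x \<in> ?C" by blast
    qed
    ultimately show ?thesis by blast
  qed
  \<comment> \<open>A point outside a set enclosing the ball of radius \<open>n\<close> satisfies
    \<open>n < d 0 x\<close>; the bound on its absolute value is a null sequence in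
    \<open>n\<close>.\<close>
  have "\<exists>x \<in> ?D. \<bar>x\<bar> < inverse (real (Suc n)) \<and> real n < d 0 x" for n
  proof -
    obtain C where C: "closed C" "C \<subseteq> ?D" "{x \<in> ?D. d 0 x \<le> real n} \<subseteq> C" using ball by blast
    obtain x where "x \<in> ?D" "\<bar>x\<bar> < inverse (real (Suc n))" "x \<notin> C"
      using closed_dyadic_omits_small[OF C(1,2), of "inverse (real (Suc n))"] by auto
    then show ?thesis using C(3) by force
  qed
  then obtain x where x: "x n \<in> ?D" "\<bar>x n\<bar> < inverse (real (Suc n))" "real n < d 0 (x n)" for n
    by metis
  have "x \<longlonglongrightarrow> 0"
    by (rule Lim_null_comparison[OF _ LIMSEQ_inverse_real_of_nat])
      (use x(2) in \<open>auto intro!: always_eventually less_imp_le\<close>)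
  then have "compact (insert 0 (range x))" by (rule compact_sequence_with_limit)
  then have K: "compactin dyadic_topology (insert 0 (range x))"
    using x(1) by (auto simp: compactin_dyadic_topology_iff dyadic_rationals_zero)
  \<comment> \<open>Take \<open>g = 0\<close>, \<open>a = 0\<close> and \<open>b = x n\<close>; this
    is why \<open>0\<close> is needed in the compact set besides being the limit.\<close>
  have "(0, x n) \<in> {(g + a, g + b) | g a b. g \<in> ?D \<and> a \<in> insert 0 (range x) \<and> b \<in> insert 0 (range x)}"
    for n
    using dyadic_rationals_zero by force
  then have "{0} \<times> range x \<in> group_compact_coarse_structure dyadic_group dyadic_topology"
    unfolding group_compact_coarse_structure_def carr mult
    using K x(1) dyadic_rationals_zero by blast
  then have "{0} \<times> range x \<in> bounded_coarse_structure (carrier dyadic_group) d"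
    unfolding eq .
  then have "bdd_above {d y z | y z. (y, z) \<in> {0} \<times> range x}"
    unfolding bounded_coarse_structure_def by simp
  then obtain M where M: "d 0 (x n) \<le> M" for n unfolding bdd_above_def by blast
  obtain n where "M \<le> real n" using real_arch_simple by blast
  with M[of n] x(3)[of n] show False by linarith
qed

end
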